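(* Let $n=2k+1$ with $k\ge 1$, let $0<\theta<\pi$, and let $\mathbf{x}=e^{\theta\mathbf{i}}=\cos\theta+\sin\theta\,\mathbf{i}\in \mathrm{SU}(2)$. For any non-trivial coloring $C$ of $T(2,n)$ by $(\mathrm{SU}(2),\mathbf{x})$ (i.e. by the conjugacy class of $\mathbf{x}$, with initial arc colored $\mathbf{x}$), the value of the longitudinal mapping is $$\mathcal{L}(C)=e^{(\pi-2n\theta)\mathbf{i}}=-\cos(2n\theta)+\sin(2n\theta)\,\mathbf{i},$$ and for any non-trivial coloring $C$ of the mirror image $m(T(2,n))$ by $(\mathrm{SU}(2),\mathbf{x})$ the value of the longitudinal mapping is $$\mathcal{L}(C)=e^{(2n\theta-\pi)\mathbf{i}}=-\cos(2n\theta)-\sin(2n\theta)\,\mathbf{i}.$$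
   Context: $\mathrm{SU}(2)$ is identified with the group of unit quaternions; for a pure unit quaternion $\mathbf{u}$, $e^{\theta\mathbf{u}}=\cos\theta+\sin\theta\,\mathbf{u}$. Wirtinger code. A 1-tangle (long knot) diagram $T$ has arcs $0,1,\dots,n$ numbered in order from the initial arc $0$ to the terminal arc $n$; at the end of arc $i-1$ one undercrosses arc $\kappa(i)$ and continues on arc $i$; $\epsilon(i)\in\{1,-1\}$ is the sign of that crossing. The pair $(\kappa,\epsilon)$ is the Wirtinger code of $T$, and $w(T)=\sum_{i}\epsilon(i)$. Colorings. For a pointed group $(G,x)$, a coloring of $T$ by $(G,x)$ is a map $C:\{0,\dots,n\}\to x^G$ (the conjugacy class of $x$) with $C(0)=x$ and $C(i)=C(\kappa(i))^{-\epsilon(i)}\,C(i-1)\,C(\kappa(i))^{\epsilon(i)}$ for $i=1,\dots,n$. (Equivalently, it is a homomorphism from the knot group to $G$ sending the meridian $x_0$ of the initial arc to $x$.) For such colorings $C(n)=C(0)$. A coloring is trivial if it is constant and non-trivial otherwise. Longitudinal mapping. $\mathcal{L}(C)=x^{-w(T)}\,C(\kappa(1))^{\epsilon(1)}C(\kappa(2))^{\epsilon(2)}\cdots C(\kappa(n))^{\epsilon(n)}$, which is the image of the preferred longitude. The torus knot $T(2,n)$, $n=2k+1$, is the closure of the positive 2-braid with $n$ crossings, all of sign $+1$. It is represented by the 1-tangle diagram with Wirtinger code $\epsilon(i)=1$ for all $i$, $\kappa(i)=k+i$ for $1\le i\le k$ and $\kappa(k+1+i)=i$ for $0\le i\le k$.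 Writing $q_{2i}=C(i)$ ($0\le i\le k$) and $q_{2i-1}=C(k+i)$ ($1\le i\le k$), the coloring condition says $q_{i+1}=q_i^{-1}q_{i-1}q_i$ for all $i$ with indices modulo $n$. The mirror image $m(T(2,n))$ is represented by the same $\kappa$ with $\epsilon(i)=-1$ for all $i$. *)

theory Defs
  imports Complex_Main "HOL-Algebra.Group"
begin

section \<open>Quaternions\<close>

datatype quat = Quat (qRe: real) (qI: real) (qJ: real) (qK: real)

lemma quat_eq_iff: "p = q \<longleftrightarrow> qRe p = qRe q \<and> qI p = qI q \<and> qJ p = qJ q \<and> qK p = qK q"
  by (cases p; cases q) simp

instantiation quat :: real_algebra_1
begin

definition "0 = Quat 0 0 0 0"
definition "1 = Quat 1 0 0 0"
definition "p + q = Quat (qRe p + qRe q) (qI p + qI q) (qJ p + qJ q) (qK p + qK q)"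
definition "- p = Quat (- qRe p) (- qI p) (- qJ p) (- qK p)"
definition "p - q = Quat (qRe p - qRe q) (qI p - qI q) (qJ p - qJ q) (qK p - qK q)"
definition "r *\<^sub>R p = Quat (r * qRe p) (r * qI p) (r * qJ p) (r * qK p)"
definition "p * q = Quat
  (qRe p * qRe q - qI p * qI q - qJ p * qJ q - qK p * qK q)
  (qRe p * qI q + qI p * qRe q + qJ p * qK q - qK p * qJ q)
  (qRe p * qJ q - qI p * qK q + qJ p * qRe q + qK p * qI q)
  (qRe p * qK q + qI p * qJ q - qJ p * qI q + qK p * qRe q)"

instance
  by standard
    (simp_all add: quat_eq_iff zero_quat_def one_quat_def plus_quat_def uminus_quat_def
      minus_quat_def scaleR_quat_def times_quat_def algebra_simps)

end

definition quat_norm :: "quat \<Rightarrow> real" where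
  "quat_norm q = sqrt ((qRe q)\<^sup>2 + (qI q)\<^sup>2 + (qJ q)\<^sup>2 + (qK q)\<^sup>2)"

definition quat_i :: quat where "quat_i = Quat 0 1 0 0"
definition quat_j :: quat where "quat_j = Quat 0 0 1 0"
definition quat_k :: quat where "quat_k = Quat 0 0 0 1"

lemma quat_units:
  "quat_i * quat_i = - 1" "quat_j * quat_j = - 1" "quat_k * quat_k = - 1"
  "quat_i * quat_j = quat_k" "quat_j * quat_k = quat_i" "quat_k * quat_i = quat_j"
  by (simp_all add: quat_i_def quat_j_def quat_k_def times_quat_def one_quat_def uminus_quat_def)

text \<open>The value \<open>e\<^sup>\<theta>\<^sup>u = cos \<theta> + sin \<theta> u\<close>; this is the exponential of \<open>\<theta>u\<close> only
  when \<open>u\<close> is a pure unit quaternion, which is how it is used.\<close>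

definition quat_cis :: "real \<Rightarrow> quat \<Rightarrow> quat" where
  "quat_cis \<theta> u = of_real (cos \<theta>) + sin \<theta> *\<^sub>R u"

text \<open>\<open>SU(2)\<close>, identified with the group of unit quaternions.\<close>

definition SU2 :: "quat monoid" where
  "SU2 = \<lparr>carrier = {q. quat_norm q = 1}, mult = (*), one = 1\<rparr>"

lemma quat_norm_mult: "quat_norm (p * q) = quat_norm p * quat_norm q"
  unfolding quat_norm_def times_quat_def real_sqrt_mult[symmetric]
  by (rule arg_cong[where f = sqrt]) (simp add: power2_eq_square algebra_simps)

lemma group_SU2: "group SU2"
proof (rule groupI)
  fix q assume "q \<in> carrier SU2"
  then have q: "(qRe q)\<^sup>2 + (qI q)\<^sup>2 + (qJ q)\<^sup>2 + (qK q)\<^sup>2 = 1"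
    by (simp add: SU2_def quat_norm_def)
  let ?c = "Quat (qRe q) (- qI q) (- qJ q) (- qK q)"
  have "quat_norm ?c = 1" using q by (simp add: quat_norm_def)
  moreover have "?c * q = 1"
    using q by (simp add: times_quat_def one_quat_def power2_eq_square algebra_simps)
  ultimately show "\<exists>y\<in>carrier SU2. y \<otimes>\<^bsub>SU2\<^esub> q = \<one>\<^bsub>SU2\<^esub>"
    by (auto simp: SU2_def)
next
  show "\<one>\<^bsub>SU2\<^esub> \<in> carrier SU2" by (simp add: SU2_def quat_norm_def one_quat_def)
qed (auto simp: SU2_def quat_norm_mult mult.assoc)

section \<open>Wirtinger codes, colorings and the longitudinal mapping\<close>

text \<open>A 1-tangle diagram with arcs \<open>0, \<dots>, n\<close> enters through its Wirtinger code: for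
  \<open>1 \<le> i \<le> n\<close>, arc \<open>i - 1\<close> ends by undercrossing arc \<open>over_arc T i\<close> at a crossing of sign
  \<open>crossing_sign T i\<close>, which is \<open>1\<close> or \<open>-1\<close>. Values at indices outside \<open>{1..n}\<close> are irrelevant.\<close>

record wirtinger_code =
  last_arc :: nat
  over_arc :: "nat \<Rightarrow> nat"
  crossing_sign :: "nat \<Rightarrow> int"

definition writhe :: "wirtinger_code \<Rightarrow> int" where
  "writhe T = (\<Sum>i = 1..last_arc T. crossing_sign T i)"

definition mirror_code :: "wirtinger_code \<Rightarrow> wirtinger_code" where
  "mirror_code T = T\<lparr>crossing_sign := (\<lambda>i. - crossing_sign T i)\<rparr>"

definition conj_class :: "('a, 'b) monoid_scheme \<Rightarrow> 'a \<Rightarrow> 'a set" where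
  "conj_class G x = {inv\<^bsub>G\<^esub> g \<otimes>\<^bsub>G\<^esub> x \<otimes>\<^bsub>G\<^esub> g | g. g \<in> carrier G}"

text \<open>A coloring is a map on the arcs \<open>{0..n}\<close>; it is given here as a function on \<open>nat\<close> of
  which only the values on \<open>{0..n}\<close> matter.\<close>

definition coloring ::
  "('a, 'b) monoid_scheme \<Rightarrow> 'a \<Rightarrow> wirtinger_code \<Rightarrow> (nat \<Rightarrow> 'a) \<Rightarrow> bool" where
  "coloring G x T C \<longleftrightarrow>
     (\<forall>i\<in>{0..last_arc T}. C i \<in> conj_class G x) \<and>
     C 0 = x \<and>
     (\<forall>i\<in>{1..last_arc T}.
        C i = C (over_arc T i) [^]\<^bsub>G\<^esub> (- crossing_sign T i) \<otimes>\<^bsub>G\<^esub> C (i - 1)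
                \<otimes>\<^bsub>G\<^esub> C (over_arc T i) [^]\<^bsub>G\<^esub> crossing_sign T i)"

definition trivial_coloring :: "wirtinger_code \<Rightarrow> (nat \<Rightarrow> 'a) \<Rightarrow> bool" where
  "trivial_coloring T C \<longleftrightarrow> (\<exists>c. \<forall>i\<in>{0..last_arc T}. C i = c)"

definition longitudinal ::
  "('a, 'b) monoid_scheme \<Rightarrow> 'a \<Rightarrow> wirtinger_code \<Rightarrow> (nat \<Rightarrow> 'a) \<Rightarrow> 'a" where
  "longitudinal G x T C =
     x [^]\<^bsub>G\<^esub> (- writhe T) \<otimes>\<^bsub>G\<^esub>
     foldr (\<lambda>i y. C (over_arc T i) [^]\<^bsub>G\<^esub> crossing_sign T i \<otimes>\<^bsub>G\<^esub> y) [1..<Suc (last_arc T)] \<one>\<^bsub>G\<^esub>"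

text \<open>The code of the 1-tangle diagram of \<open>T(2, 2k + 1)\<close>. In the second branch,
  \<open>i = k + 1 + j\<close> with \<open>0 \<le> j \<le> k\<close> is sent to \<open>j\<close>.\<close>

definition torus_code :: "nat \<Rightarrow> wirtinger_code" where
  "torus_code k =
     \<lparr>last_arc = 2 * k + 1,
      over_arc = (\<lambda>i. if i \<le> k then k + i else i - (k + 1)),
      crossing_sign = (\<lambda>i. 1)\<rparr>"

end

theory Submission
  imports Defs
begin

text \<open>
  Put \<open>a\<^sub>i = C(i)\<close> and \<open>b\<^sub>i = C(k + 1 + i)\<close> for \<open>0 \<le> i \<le> k\<close>. The coloring conditions say that all
  products \<open>a\<^sub>i b\<^sub>i\<close>, \<open>b\<^sub>i a\<^sub>i\<^sub>+\<^sub>1\<close> and \<open>a\<^sub>k a\<^sub>0\<close> equal one element \<open>p\<close>. Hence \<open>p\<^sup>i a\<^sub>i = x p\<^sup>i\<close>, the product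
  of the over-arcs is \<open>x\<^sup>-\<^sup>n p\<^sup>n\<close>, and \<open>y = x p\<^sup>k\<close> satisfies \<open>y\<^sup>2 = p\<^sup>n\<close>. A unit
  quaternion satisfies \<open>y\<^sup>2 = 2 Re(y) y - 1\<close>, so that \<open>p\<close>, which commutes with \<open>y\<^sup>2\<close>, commutes
  with \<open>y\<close> unless \<open>y\<^sup>2 = -1\<close>. In the first case the coloring is constant; in the second the product
  of the over-arcs is \<open>-x\<^sup>-\<^sup>n\<close>. For the mirror image, the pointwise inverse of a coloring is a
  coloring of \<open>T(2,n)\<close> by \<open>x\<^sup>-\<^sup>1\<close>, with the same product of over-arcs.
\<close>

section \<open>Quaternions\<close>

lemma quat_norm_eq_0_iff: "quat_norm q = 0 \<longleftrightarrow> q = 0"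
  by (simp add: quat_norm_def quat_eq_iff zero_quat_def add_nonneg_eq_0_iff)

text \<open>The norm is multiplicative and vanishes only at 0. The instance supplies the
  cancellation of powers of \<open>p\<close> used below.\<close>

instance quat :: ring_1_no_zero_divisors
  by standard (metis mult_eq_0_iff quat_norm_eq_0_iff quat_norm_mult)

text \<open>This is the characteristic equation of a quaternion with trace \<open>2 * qRe y\<close>
  and norm 1.\<close>

lemma unit_quat_square:
  assumes "quat_norm y = 1"
  shows "y * y = (2 * qRe y) *\<^sub>R y - 1"
proof -
  have "(qRe y)\<^sup>2 + (qI y)\<^sup>2 + (qJ y)\<^sup>2 + (qK y)\<^sup>2 = 1"
    using assms by (simp add: quat_norm_def)
  then show ?thesis
    by (simp add: quat_eq_iff times_quat_def scaleR_quat_def minus_quat_def one_quat_def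
        power2_eq_square algebra_simps)
qed

lemma unit_quat_square_eq_minus_1:
  assumes "quat_norm y = 1" "p * (y * y) = y * y * p" "p * y \<noteq> y * p"
  shows "y * y = - 1"
proof -
  \<comment> \<open>Once the quadratic equation replaces \<open>y * y\<close>, the constant terms
    cancel and a multiple of the commutator remains.\<close>
  have "(2 * qRe y) *\<^sub>R (p * y - y * p) = 0"
    using assms(2) unfolding unit_quat_square[OF assms(1)] by (simp add: algebra_simps)
  then have "qRe y = 0"
    using assms(3) by simp
  then show ?thesis
    using unit_quat_square[OF assms(1)] by simp
qed

lemma quat_cis_mult:
  assumes "u * u = - 1"
  shows "quat_cis a u * quat_cis b u = quat_cis (a + b) u"
proof -
  have "quat_cis a u * quat_cis b u =
      of_real (cos a * cos b) + (cos a * sin b + sin a * cos b) *\<^sub>R u + (sin a * sin b) *\<^sub>R (u * u)"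
    by (simp add: quat_cis_def of_real_def algebra_simps)
  also have "\<dots> = quat_cis (a + b) u"
    by (simp add: assms quat_cis_def of_real_def cos_add sin_add algebra_simps)
  finally show ?thesis .
qed

lemma quat_cis_0 [simp]: "quat_cis 0 u = 1"
  by (simp add: quat_cis_def)

lemma quat_cis_pi_minus: "quat_cis (pi - t) u = - of_real (cos t) + sin t *\<^sub>R u"
  by (simp add: quat_cis_def)

lemma quat_cis_minus_pi: "quat_cis (t - pi) u = - of_real (cos t) - sin t *\<^sub>R u"
  by (simp add: quat_cis_def)

lemma quat_norm_cis_i [simp]: "quat_norm (quat_cis t quat_i) = 1"
  by (simp add: quat_norm_def quat_cis_def quat_i_def of_real_def plus_quat_def scaleR_quat_def
      one_quat_def)

lemma power_quat_cis: "u * u = - 1 \<Longrightarrow> quat_cis t u ^ m = quat_cis (real m * t) u"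
  by (induction m) (simp_all add: quat_cis_mult algebra_simps)

section \<open>The group of unit quaternions\<close>

interpretation SU2: group SU2
  by (rule group_SU2)

lemma SU2_simps [simp]:
  "q \<in> carrier SU2 \<longleftrightarrow> quat_norm q = 1" "p \<otimes>\<^bsub>SU2\<^esub> q = p * q" "\<one>\<^bsub>SU2\<^esub> = 1"
  by (simp_all add: SU2_def)

lemma SU2_nat_pow [simp]: "q [^]\<^bsub>SU2\<^esub> (m::nat) = q ^ m"
  by (induction m) (simp_all add: power_Suc2 del: power_Suc)

lemma SU2_inv_mult: "quat_norm q = 1 \<Longrightarrow> inv\<^bsub>SU2\<^esub> q * q = 1" "quat_norm q = 1 \<Longrightarrow> q * inv\<^bsub>SU2\<^esub> q = 1"
  using SU2.l_inv[of q] SU2.r_inv[of q] by simp_all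

lemma SU2_inv_cis: "inv\<^bsub>SU2\<^esub> (quat_cis t quat_i) = quat_cis (- t) quat_i"
  by (rule SU2.inv_equality) (simp_all add: quat_cis_mult quat_units)

lemma SU2_int_pow_cis:
  "quat_cis t quat_i [^]\<^bsub>SU2\<^esub> (m::int) = quat_cis (of_int m * t) quat_i"
proof (cases m)
  case (nonneg j)
  then show ?thesis
    by (simp add: int_pow_int power_quat_cis quat_units)
next
  case (neg j)
  then show ?thesis
    by (simp add: SU2.int_pow_neg_int power_quat_cis quat_units SU2_inv_cis del: nat_pow_Suc power_Suc of_nat_Suc)
qed

text \<open>Colors are conjugates of \<open>x\<close>, and the norm is multiplicative.\<close>

lemma coloring_SU2_unit:
  assumes "coloring SU2 x T C" "quat_norm x = 1" "i \<le> last_arc T"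
  shows "quat_norm (C i) = 1"
proof -
  obtain g where "quat_norm g = 1" "C i = inv\<^bsub>SU2\<^esub> g * x * g"
  proof -
    have "C i \<in> conj_class SU2 x"
      using assms(1,3) by (simp add: coloring_def)
    then show ?thesis
      using that by (auto simp: conj_class_def)
  qed
  then show ?thesis
    using SU2.inv_closed[of g] assms(2) by (simp add: quat_norm_mult)
qed

lemma foldr_times: "foldr (\<lambda>i y. f i * y) is 1 = prod_list (map f is)"
  by (induction "is") simp_all

section \<open>Relations of the torus code\<close>

text \<open>\<open>q\<^sub>0, \<dots>, q\<^sub>2\<^sub>k\<close> are interleaved here as \<open>a\<^sub>i = q\<^sub>2\<^sub>i\<close> and \<open>b\<^sub>i = q\<^sub>2\<^sub>i\<^sub>+\<^sub>1\<close>; all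
  identities are free of inverses, so that they hold in any monoid.\<close>

context
  fixes a b :: "nat \<Rightarrow> 'a::monoid_mult" and p :: 'a and k :: nat
  assumes ab: "\<And>i. i \<le> k \<Longrightarrow> a i * b i = p"
    and ba: "\<And>i. i < k \<Longrightarrow> b i * a (Suc i) = p"
    and wrap: "a k * a 0 = p"
begin

lemma power_mult_a: "i \<le> k \<Longrightarrow> p ^ i * a i = a 0 * p ^ i"
proof (induction i)
  case (Suc i)
  \<comment> \<open>Both sides equal \<open>a i * b i * a (Suc i)\<close>: moving past
    \<open>p\<close> shifts the index by one.\<close>
  have "p * a (Suc i) = a i * p"
    using ab[of i] ba[of i] Suc.prems by (metis Suc_le_eq less_imp_le mult.assoc)
  then have "p ^ Suc i * a (Suc i) = p ^ i * a i * p"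
    by (simp add: power_Suc2 mult.assoc del: power_Suc)
  with Suc show ?case
    by (simp add: power_Suc2 mult.assoc del: power_Suc)
qed simp

text \<open>Each new factor \<open>a 0\<close> passes through \<open>p ^ m\<close>, becomes
  \<open>a m\<close> and pairs with \<open>b m\<close> to give \<open>p\<close>.\<close>

lemma prod_b: "m \<le> k \<Longrightarrow> a 0 ^ m * prod_list (map b [0..<m]) = p ^ m"
proof (induction m)
  case (Suc m)
  have "a 0 ^ Suc m * prod_list (map b [0..<Suc m]) = a 0 * (a 0 ^ m * prod_list (map b [0..<m])) * b m"
    by (simp add: mult.assoc)
  also have "\<dots> = p ^ m * a m * b m"
    using Suc power_mult_a[of m] by simp
  also have "\<dots> = p ^ Suc m"
    using ab[of m] Suc.prems by (simp add: mult.assoc power_Suc2 del: power_Suc)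
  finally show ?case .
qed simp

text \<open>Here \<open>a m\<close> moves left through \<open>p ^ m\<close>, becomes
  \<open>a 0\<close> and meets \<open>a k\<close>, so \<open>wrap\<close> applies; hence powers of
  \<open>a k\<close> instead of \<open>a 0\<close>.\<close>

lemma prod_a: "m \<le> Suc k \<Longrightarrow> a k ^ m * prod_list (map a [0..<m]) = p ^ m"
proof (induction m)
  case (Suc m)
  have "a k ^ Suc m * prod_list (map a [0..<Suc m]) = a k * (a k ^ m * prod_list (map a [0..<m])) * a m"
    by (simp add: mult.assoc)
  also have "\<dots> = a k * a 0 * p ^ m"
    using Suc power_mult_a[of m] by (simp add: mult.assoc)
  also have "\<dots> = p ^ Suc m"
    by (simp add: wrap)
  finally show ?case .
qed simp

lemma prod_b_a:
  "a 0 ^ (2 * k + 1) * (prod_list (map b [0..<k]) * prod_list (map a [0..<Suc k])) = p ^ (2 * k + 1)"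
proof -
  \<comment> \<open>\<open>prod_b\<close> leaves \<open>p ^ k\<close> behind powers of
    \<open>a 0\<close>; moving it to the front turns them into the powers of \<open>a k\<close> that
    \<open>prod_a\<close> absorbs.\<close>
  have conj: "a 0 ^ m * p ^ k = p ^ k * a k ^ m" for m
  proof (induction m)
    case (Suc m)
    have "a 0 ^ Suc m * p ^ k = a 0 * p ^ k * a k ^ m"
      using Suc by (simp add: mult.assoc)
    also have "\<dots> = p ^ k * a k * a k ^ m"
      using power_mult_a[of k] by simp
    finally show ?case
      by (simp add: mult.assoc)
  qed simp
  let ?B = "prod_list (map b [0..<k])" and ?A = "prod_list (map a [0..<Suc k])"
  have "2 * k + 1 = Suc k + k" by simp
  then have "a 0 ^ (2 * k + 1) * (?B * ?A) = a 0 ^ Suc k * (a 0 ^ k * ?B) * ?A"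
    by (simp only: power_add mult.assoc)
  also have "\<dots> = p ^ k * (a k ^ Suc k * ?A)"
    using prod_b[of k] conj[of "Suc k"] by (simp only: mult.assoc order_refl)
  also have "\<dots> = p ^ k * p ^ Suc k"
    using prod_a[of "Suc k"] by (simp only: order_refl)
  also have "\<dots> = p ^ (2 * k + 1)"
    by (simp flip: power_add power_Suc add: mult_2)
  finally show ?thesis .
qed

lemma square_eq_power: "a 0 * p ^ k * (a 0 * p ^ k) = p ^ (2 * k + 1)"
proof -
  \<comment> \<open>Only the first factor is rewritten, as \<open>p ^ k * a k\<close>, which brings
    \<open>a k\<close> next to \<open>a 0\<close>.\<close>
  have "a 0 * p ^ k * (a 0 * p ^ k) = p ^ k * (a k * a 0) * p ^ k"
    using power_mult_a[of k] by (metis mult.assoc order_refl)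
  also have "\<dots> = p ^ k * (p * p ^ k)"
    by (simp add: wrap mult.assoc)
  also have "\<dots> = p ^ (2 * k + 1)"
    by (simp flip: power_add power_Suc add: mult_2)
  finally show ?thesis .
qed

end

text \<open>Commutation turns the shift \<open>p ^ j * a j = a 0 * p ^ j\<close> into an equation
  from which \<open>p ^ j\<close> cancels; the \<open>b i\<close> then follow from
  \<open>a 0 * b i = p = a 0 * a 0\<close>.\<close>

lemma constant_if_commute:
  fixes a b :: "nat \<Rightarrow> 'a::ring_1_no_zero_divisors"
  assumes ab: "\<And>i. i \<le> k \<Longrightarrow> a i * b i = p"
    and ba: "\<And>i. i < k \<Longrightarrow> b i * a (Suc i) = p"
    and wrap: "a k * a 0 = p"
    and comm: "a 0 * p = p * a 0" and nz: "p \<noteq> 0" and i: "i \<le> k"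
  shows "a i = a 0 \<and> b i = a 0"
proof -
  have a: "a j = a 0" if "j \<le> k" for j
  proof -
    have "p ^ j * a j = p ^ j * a 0"
      using power_mult_a[OF ab ba wrap that] power_commuting_commutes[OF comm[symmetric]] by simp
    then show ?thesis
      using nz by simp
  qed
  have "a 0 * b i = a 0 * a 0"
    using ab[OF i] a[OF i] a[of k] wrap by simp
  moreover have "a 0 \<noteq> 0"
    using wrap nz by auto
  ultimately show ?thesis
    using a[OF i] by simp
qed

text \<open>The relations are stated without inverses or a conjugacy class, so as to serve both
  colorings of the torus code and inverted colorings of its mirror image.\<close>

lemma torus_product:
  fixes C :: "nat \<Rightarrow> quat"
  assumes unit: "\<And>i. i \<le> 2 * k + 1 \<Longrightarrow> quat_norm (C i) = 1"
    and rel: "\<And>i. 1 \<le> i \<Longrightarrow> i \<le> 2 * k + 1 \<Longrightarrow>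
      C (over_arc (torus_code k) i) * C i = C (i - 1) * C (over_arc (torus_code k) i)"
    and nontriv: "\<not> trivial_coloring (torus_code k) C"
  shows "C 0 ^ (2 * k + 1) *
    prod_list (map (\<lambda>i. C (over_arc (torus_code k) i)) [1..<Suc (2 * k + 1)]) = - 1"
proof -
  define a b p where "a = C" and "b = (\<lambda>i. C (k + 1 + i))" and "p = C k * C 0"
  have ba_ab: "b i * a (Suc i) = a i * b i" if "i < k" for i
    using rel[of "Suc i"] that by (simp add: a_def b_def torus_code_def)
  have ab_ba: "a (Suc i) * b (Suc i) = b i * a (Suc i)" if "i < k" for i
    using rel[of "k + 1 + Suc i"] that by (simp add: a_def b_def torus_code_def)
  \<comment> \<open>The induction starts at crossing \<open>k + 1\<close>, where arc
    \<open>k\<close> passes under arc 0; the other crossings propagate the product.\<close>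
  have ab: "a i * b i = p" if "i \<le> k" for i
    using that
  proof (induction i)
    case 0
    then show ?case
      using rel[of "k + 1"] by (simp add: a_def b_def p_def torus_code_def)
  qed (simp add: ab_ba ba_ab)
  have ba: "b i * a (Suc i) = p" if "i < k" for i
    using ba_ab ab that by simp
  have wrap: "a k * a 0 = p"
    by (simp add: a_def p_def)
  have norm_p: "quat_norm p = 1"
    by (simp add: p_def quat_norm_mult unit)
  have nz: "p \<noteq> 0"
    using norm_p quat_norm_eq_0_iff[of p] by auto
  have norm_pow: "quat_norm (p ^ j) = 1" for j
    by (induction j) (simp_all add: quat_norm_mult norm_p, simp add: quat_norm_def one_quat_def)
  let ?y = "a 0 * p ^ k"
  have "a 0 * p \<noteq> p * a 0"
  proof
    assume "a 0 * p = p * a 0"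
    then have const: "a i = a 0 \<and> b i = a 0" if "i \<le> k" for i
      using constant_if_commute[OF ab ba wrap _ nz that] by simp
    have "C i = a 0" if "i \<le> 2 * k + 1" for i
    proof (cases "i \<le> k")
      case True
      then show ?thesis
        using const[of i] by (simp add: a_def)
    next
      case False
      then show ?thesis
        using const[of "i - (k + 1)"] that by (simp add: b_def)
    qed
    then show False
      using nontriv by (auto simp: trivial_coloring_def torus_code_def)
  qed
  \<comment> \<open>Cancelling \<open>p ^ k\<close>, which commutes with \<open>p\<close>, carries
    non-commutation from \<open>a 0\<close> over to \<open>?y\<close>.\<close>
  then have "(p * a 0) * p ^ k \<noteq> (a 0 * p) * p ^ k"
    using nz by auto
  then have "p * ?y \<noteq> ?y * p"
    by (simp add: mult.assoc power_commutes)
  moreover have sq: "?y * ?y = p ^ (2 * k + 1)"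
    by (rule square_eq_power[OF ab ba wrap])
  moreover have "p * (?y * ?y) = ?y * ?y * p"
    by (simp only: sq power_commutes)
  moreover have "quat_norm ?y = 1"
    by (simp add: quat_norm_mult norm_pow a_def unit)
  ultimately have "p ^ (2 * k + 1) = - 1"
    using unit_quat_square_eq_minus_1 by metis
  \<comment> \<open>The over-arcs are \<open>k + 1\<close> to \<open>2 * k\<close>, then 0 to
    \<open>k\<close>; the last arc, colored \<open>b k\<close>, never passes over.\<close>
  moreover have "map (\<lambda>i. C (over_arc (torus_code k) i)) [1..<Suc (2 * k + 1)] =
      map b [0..<k] @ map a [0..<Suc k]"
    by (rule nth_equalityI) (auto simp: nth_append a_def b_def torus_code_def simp del: upt_Suc)
  ultimately show ?thesis
    using prod_b_a[OF ab ba wrap] by (simp only: prod_list.append) (simp add: a_def)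
qed

lemma torus_product_cis:
  assumes "\<And>i. i \<le> 2 * k + 1 \<Longrightarrow> quat_norm (C i) = 1"
    and "\<And>i. 1 \<le> i \<Longrightarrow> i \<le> 2 * k + 1 \<Longrightarrow>
      C (over_arc (torus_code k) i) * C i = C (i - 1) * C (over_arc (torus_code k) i)"
    and "\<not> trivial_coloring (torus_code k) C"
    and "C 0 = quat_cis t quat_i"
  shows "quat_cis (- (real (2 * k + 1) * t)) quat_i *
    prod_list (map (\<lambda>i. C (over_arc (torus_code k) i)) [1..<Suc (2 * k + 1)]) =
    quat_cis (pi - 2 * real (2 * k + 1) * t) quat_i"
proof -
  let ?n = "2 * k + 1"
  let ?P = "prod_list (map (\<lambda>i. C (over_arc (torus_code k) i)) [1..<Suc ?n])"
  let ?c = "\<lambda>s. quat_cis s quat_i"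
  have P: "?c (real ?n * t) * ?P = - 1"
    using torus_product[OF assms(1-3)] by (simp only: assms(4) power_quat_cis quat_units)
  \<comment> \<open>The angle is split so that the second factor completes the product known to be
    -1, a half-turn.\<close>
  have "?c (- (real ?n * t)) * ?P = ?c (- (2 * real ?n * t)) * (?c (real ?n * t) * ?P)"
    by (simp add: quat_cis_mult quat_units algebra_simps flip: mult.assoc[of "quat_cis _ _"] del: upt_Suc)
  also have "\<dots> = - ?c (- (2 * real ?n * t))"
    unfolding P by simp
  also have "\<dots> = ?c (pi - 2 * real ?n * t)"
    by (simp add: quat_cis_def)
  finally show ?thesis .
qed

section \<open>The longitudinal mapping\<close>

lemma last_arc_torus [simp]: "last_arc (torus_code k) = 2 * k + 1"
  by (simp add: torus_code_def)

lemma crossing_sign_torus [simp]: "crossing_sign (torus_code k) i = 1"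
  by (simp add: torus_code_def)

lemma mirror_code_simps [simp]:
  "last_arc (mirror_code T) = last_arc T"
  "over_arc (mirror_code T) = over_arc T"
  "crossing_sign (mirror_code T) i = - crossing_sign T i"
  by (simp_all add: mirror_code_def)

lemma over_arc_torus_le: "i \<le> 2 * k + 1 \<Longrightarrow> over_arc (torus_code k) i \<le> 2 * k + 1"
  by (auto simp: torus_code_def)

lemma longitudinal_torus:
  assumes col: "coloring SU2 (quat_cis t quat_i) (torus_code k) C"
    and nontriv: "\<not> trivial_coloring (torus_code k) C"
  shows "longitudinal SU2 (quat_cis t quat_i) (torus_code k) C =
    quat_cis (pi - 2 * real (2 * k + 1) * t) quat_i"
proof -
  let ?o = "over_arc (torus_code k)"
  have unit: "quat_norm (C i) = 1" if "i \<le> 2 * k + 1" for i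
    using coloring_SU2_unit[OF col] that by simp
  have o: "quat_norm (C (?o i)) = 1" if "i \<le> 2 * k + 1" for i
    by (rule unit[OF over_arc_torus_le[OF that]])
  have rel: "C (?o i) * C i = C (i - 1) * C (?o i)" if "1 \<le> i" "i \<le> 2 * k + 1" for i
  proof -
    have "C i = inv\<^bsub>SU2\<^esub> (C (?o i)) * C (i - 1) * C (?o i)"
      using col that o[OF that(2)] by (simp add: coloring_def SU2.int_pow_neg SU2.int_pow_1)
    then show ?thesis
      using SU2_inv_mult(2)[OF o[OF that(2)]] by (metis mult.assoc mult_1)
  qed
  have "longitudinal SU2 (quat_cis t quat_i) (torus_code k) C =
      quat_cis (- (real (2 * k + 1) * t)) quat_i *
        prod_list (map (\<lambda>i. C (?o i) [^]\<^bsub>SU2\<^esub> (1::int)) [1..<Suc (2 * k + 1)])"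
    by (simp add: longitudinal_def writhe_def SU2_int_pow_cis foldr_times algebra_simps del: upt_Suc)
  also have "map (\<lambda>i. C (?o i) [^]\<^bsub>SU2\<^esub> (1::int)) [1..<Suc (2 * k + 1)] =
      map (\<lambda>i. C (?o i)) [1..<Suc (2 * k + 1)]"
    by (rule map_cong) (auto simp: o SU2.int_pow_1 simp del: upt_Suc)
  also have "quat_cis (- (real (2 * k + 1) * t)) quat_i * prod_list \<dots> =
      quat_cis (pi - 2 * real (2 * k + 1) * t) quat_i"
    using col by (intro torus_product_cis unit rel nontriv) (simp_all add: coloring_def)
  finally show ?thesis .
qed

lemma longitudinal_mirror_torus:
  assumes col: "coloring SU2 (quat_cis t quat_i) (mirror_code (torus_code k)) C"
    and nontriv: "\<not> trivial_coloring (mirror_code (torus_code k)) C"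
  shows "longitudinal SU2 (quat_cis t quat_i) (mirror_code (torus_code k)) C =
    quat_cis (2 * real (2 * k + 1) * t - pi) quat_i"
proof -
  let ?o = "over_arc (torus_code k)"
  define D where "D i = inv\<^bsub>SU2\<^esub> (C i)" for i
  have unit: "quat_norm (C i) = 1" if "i \<le> 2 * k + 1" for i
    using coloring_SU2_unit[OF col] that by simp
  have o: "quat_norm (C (?o i)) = 1" if "i \<le> 2 * k + 1" for i
    by (rule unit[OF over_arc_torus_le[OF that]])
  have unit_D: "quat_norm (D i) = 1" if "i \<le> 2 * k + 1" for i
    using SU2.inv_closed[of "C i"] unit[OF that] by (simp add: D_def)
  have rel: "D (?o i) * D i = D (i - 1) * D (?o i)" if "1 \<le> i" "i \<le> 2 * k + 1" for i
  proof -
    have i: "quat_norm (C i) = 1" "quat_norm (C (i - 1)) = 1"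
      using that by (auto intro!: unit)
    have "C i = C (?o i) * C (i - 1) * inv\<^bsub>SU2\<^esub> (C (?o i))"
      using col that o[OF that(2)] by (simp add: coloring_def SU2.int_pow_neg SU2.int_pow_1)
    then have "C i * C (?o i) = C (?o i) * C (i - 1)"
      using SU2_inv_mult(1)[OF o[OF that(2)]] by (metis mult.assoc mult_1_right)
    \<comment> \<open>Inverting both sides reverses the factors and yields the relation of the
      positive crossing.\<close>
    then show ?thesis
      using SU2.inv_mult_group[of "C i" "C (?o i)"] SU2.inv_mult_group[of "C (?o i)" "C (i - 1)"]
        i o[OF that(2)] by (simp add: D_def)
  qed
  have nontriv_D: "\<not> trivial_coloring (torus_code k) D"
  proof
    assume "trivial_coloring (torus_code k) D"
    then obtain c where c: "\<And>i. i \<le> 2 * k + 1 \<Longrightarrow> D i = c"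
      by (auto simp: trivial_coloring_def)
    have "C i = inv\<^bsub>SU2\<^esub> c" if "i \<le> 2 * k + 1" for i
      using c[OF that] unit[OF that] SU2.inv_inv[of "C i"] by (auto simp: D_def)
    then show False
      using nontriv by (auto simp: trivial_coloring_def)
  qed
  have D0: "D 0 = quat_cis (- t) quat_i"
    using col by (simp add: coloring_def D_def SU2_inv_cis)
  \<comment> \<open>The writhe is now negative; the angle is written with \<open>- t\<close> because
    \<open>D 0\<close> has that angle.\<close>
  have "longitudinal SU2 (quat_cis t quat_i) (mirror_code (torus_code k)) C =
      quat_cis (- (real (2 * k + 1) * (- t))) quat_i *
        prod_list (map (\<lambda>i. C (?o i) [^]\<^bsub>SU2\<^esub> (- 1::int)) [1..<Suc (2 * k + 1)])"
    by (simp add: longitudinal_def writhe_def SU2_int_pow_cis foldr_times algebra_simps del: upt_Suc)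
  also have "map (\<lambda>i. C (?o i) [^]\<^bsub>SU2\<^esub> (- 1::int)) [1..<Suc (2 * k + 1)] =
      map (\<lambda>i. D (?o i)) [1..<Suc (2 * k + 1)]"
    by (rule map_cong) (auto simp: o D_def SU2.int_pow_neg SU2.int_pow_1 simp del: upt_Suc)
  also have "quat_cis (- (real (2 * k + 1) * (- t))) quat_i * prod_list \<dots> =
      quat_cis (pi - 2 * real (2 * k + 1) * (- t)) quat_i"
    by (intro torus_product_cis unit_D rel nontriv_D D0)
  \<comment> \<open>The two angles differ by a full turn, so their sines and cosines are
    compared.\<close>
  also have "\<dots> = quat_cis (2 * real (2 * k + 1) * t - pi) quat_i"
    by (simp only: quat_cis_pi_minus quat_cis_minus_pi mult_minus_right cos_minus sin_minus
        scaleR_minus_left add_uminus_conv_diff)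
  finally show ?thesis .
qed

theorem theorem6p5:
  fixes k n :: nat and \<theta> :: real and x :: quat
  assumes "k \<ge> 1" and "n = 2 * k + 1"
    and "0 < \<theta>" and "\<theta> < pi"
    and "x = quat_cis \<theta> quat_i"
  shows "(\<forall>C. coloring SU2 x (torus_code k) C \<and> \<not> trivial_coloring (torus_code k) C \<longrightarrow>
            longitudinal SU2 x (torus_code k) C = quat_cis (pi - 2 * real n * \<theta>) quat_i \<and>
            longitudinal SU2 x (torus_code k) C =
              - of_real (cos (2 * real n * \<theta>)) + sin (2 * real n * \<theta>) *\<^sub>R quat_i) \<and>
         (\<forall>C. coloring SU2 x (mirror_code (torus_code k)) C \<and>
              \<not> trivial_coloring (mirror_code (torus_code k)) C \<longrightarrow>
            longitudinal SU2 x (mirror_code (torus_code k)) C = quat_cis (2 * real n * \<theta> - pi) quat_i \<and>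
            longitudinal SU2 x (mirror_code (torus_code k)) C =
              - of_real (cos (2 * real n * \<theta>)) - sin (2 * real n * \<theta>) *\<^sub>R quat_i)"
  unfolding assms(2,5)
  using longitudinal_torus longitudinal_mirror_torus quat_cis_pi_minus quat_cis_minus_pi by metis

end
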